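(* Let $\mathfrak g$ be a nonzero simple complete left-symmetric algebra over $\mathbb C$ whose canonical decomposition $\mathfrak g=\bigoplus_\lambda\mathfrak g^\lambda$ satisfies $\dim\mathfrak g^\lambda\le 1$ for all $\lambda$. Then the vertex $0$ is reachable (by a directed path, possibly of length zero) from any point $\lambda\in\Lambda$ in the union of the graphs $\Gamma_l$ and $\Gamma_r$.
   Context: All algebras are finite dimensional. A left-symmetric algebra is a vector space $\mathfrak g$ with a bilinear product such that $x(yz)-(xy)z=y(xz)-(yx)z$ for all $x,y,z$. Then $[x,y]=xy-yx$ is a Lie bracket and $L(x)y=xy$ defines a representation of the Lie algebra $\mathfrak g$. The fields $F_x(y)=xy+x$, $x\in\mathfrak g$, form a Lie algebra of affine vector fields on the space $\mathfrak g$; $\mathfrak g$ is complete if the group of affine transformations generated by their flows acts transitively on $\mathfrak g$. A subspace $\mathfrak j$ is an ideal if $\mathfrak j\mathfrak g\subseteq\mathfrak j$ and $\mathfrak g\mathfrak j\subseteq\mathfrak j$; $\mathfrak g$ is simple if it has no ideals other than $0$ and $\mathfrak g$. Canonical decomposition: a complete left-symmetric algebra over $\mathbb C$ has a unique Cartan subalgebra $\mathfrak h$ of the Lie algebra $\mathfrak g$ such that, for every linear functional $\lambda$ on $\mathfrak h$, the root subspace (generalized weight space) $\mathfrak g^\lambda$ of $\lambda$ for $L|_{\mathfrak h}$ equals the root subspace for $\operatorname{ad}|_{\mathfrak h}$; the canonical decomposition is $\mathfrak g=\bigoplus_\lambda\mathfrak g^\lambda$, and $\mathfrak g^0=\mathfrak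 h$. It satisfies $\mathfrak g^\lambda\mathfrak g^\mu\subseteq\mathfrak g^{\lambda+\mu}$. Graphs: assume $\dim\mathfrak g^\lambda\le1$ for all $\lambda$. Fix $e_0\in\mathfrak g^0$, $e_0\neq0$. Identify each functional $\lambda$ with $\mathfrak g^\lambda\ne0$ with the number $\lambda(e_0)$; the set of these numbers is $\Lambda\subset\mathbb C$, the spectrum of $L(e_0)$ (it contains $0$). For each $\lambda\in\Lambda$ choose an eigenvector $e_\lambda\in\mathfrak g^\lambda$, $e_0e_\lambda=\lambda e_\lambda$ (with the chosen $e_0$ for $\lambda=0$). In the base $\{e_\lambda\}_{\lambda\in\Lambda}$ the product is $e_\lambda e_\mu=c_{\lambda,\mu}e_{\lambda+\mu}$, with the convention $e_\lambda=0$ and $c_{\lambda,\mu}=c_{\mu,\lambda}=0$ if $\lambda\notin\Lambda$. $\Gamma_l$ and $\Gamma_r$ are the directed graphs (loops allowed) with vertex set $\Lambda$: $\Gamma_l$ has an edge from $\lambda$ to $\mu$ if and only if $c_{\mu-\lambda,\lambda}\neq0$; $\Gamma_r$ has an edge from $\lambda$ to $\mu$ if and only if $c_{\lambda,\mu-\lambda}\neq0$. Their union has vertex set $\Lambda$ and all edges of both graphs. *)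

theory Defs
  imports "HOL-Analysis.Analysis" "HOL-Algebra.Bij" "HOL-Algebra.Generated_Groups"
begin

text \<open>
  A nonzero finite-dimensional complex vector space is represented by \<^typ>\<open>complex ^ 'n\<close> with
  \<open>'n\<close> an arbitrary finite type; the scalar multiplication is \<open>*s\<close>. A product is a
  curried binary function \<open>m\<close>, so that the left multiplication by \<open>x\<close> is \<open>m x\<close>.
\<close>

type_synonym 'n product = "complex ^ 'n \<Rightarrow> complex ^ 'n \<Rightarrow> complex ^ 'n"

definition bilinear_product :: "'n::finite product \<Rightarrow> bool" where
  "bilinear_product m \<longleftrightarrow>
     (\<forall>x. Vector_Spaces.linear (*s) (*s) (\<lambda>y. m x y)) \<and>
     (\<forall>y. Vector_Spaces.linear (*s) (*s) (\<lambda>x. m x y))"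

definition left_symmetric_algebra :: "'n::finite product \<Rightarrow> bool" where
  "left_symmetric_algebra m \<longleftrightarrow> bilinear_product m \<and>
     (\<forall>x y z. m x (m y z) - m (m x y) z = m y (m x z) - m (m y x) z)"

definition bracket :: "'n::finite product \<Rightarrow> 'n product" where
  "bracket m x y = m x y - m y x"

definition lsa_ideal :: "'n::finite product \<Rightarrow> (complex ^ 'n) set \<Rightarrow> bool" where
  "lsa_ideal m J \<longleftrightarrow> vec.subspace J \<and> (\<forall>x\<in>J. \<forall>y. m x y \<in> J \<and> m y x \<in> J)"

definition simple_lsa :: "'n::finite product \<Rightarrow> bool" where
  "simple_lsa m \<longleftrightarrow> (\<forall>J. lsa_ideal m J \<longrightarrow> J = {0} \<or> J = UNIV)"


text \<open>
  Flows are taken in real time. As \<open>t F\<^sub>x = F\<^bsub>t x\<^esub>\<close> also for complex \<open>t\<close>, complex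
  time gives the same group.
\<close>

definition affine_field :: "'n::finite product \<Rightarrow> complex ^ 'n \<Rightarrow> complex ^ 'n \<Rightarrow> complex ^ 'n" where
  "affine_field m x y = m x y + x"

definition is_flow ::
  "(complex ^ 'n \<Rightarrow> complex ^ 'n) \<Rightarrow> (real \<Rightarrow> complex ^ 'n \<Rightarrow> complex ^ 'n::finite) \<Rightarrow> bool" where
  "is_flow F \<phi> \<longleftrightarrow> (\<forall>y. \<phi> 0 y = y \<and>
     (\<forall>t. ((\<lambda>s. \<phi> s y) has_vector_derivative F (\<phi> t y)) (at t)))"

definition flow_group :: "'n::finite product \<Rightarrow> (complex ^ 'n \<Rightarrow> complex ^ 'n) set" where
  "flow_group m = generate (BijGroup UNIV) {\<phi> t | \<phi> t x. is_flow (affine_field m x) \<phi>}"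

definition complete_lsa :: "'n::finite product \<Rightarrow> bool" where
  "complete_lsa m \<longleftrightarrow> (\<forall>y z. \<exists>g \<in> flow_group m. g y = z)"


definition lie_subalgebra :: "'n::finite product \<Rightarrow> (complex ^ 'n) set \<Rightarrow> bool" where
  "lie_subalgebra m h \<longleftrightarrow> vec.subspace h \<and> (\<forall>x\<in>h. \<forall>y\<in>h. bracket m x y \<in> h)"

fun lower_central :: "'n::finite product \<Rightarrow> (complex ^ 'n) set \<Rightarrow> nat \<Rightarrow> (complex ^ 'n) set" where
  "lower_central m h 0 = h"
| "lower_central m h (Suc k) = vec.span {bracket m x y | x y. x \<in> h \<and> y \<in> lower_central m h k}"

definition lie_normalizer :: "'n::finite product \<Rightarrow> (complex ^ 'n) set \<Rightarrow> (complex ^ 'n) set" where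
  "lie_normalizer m h = {x. \<forall>y\<in>h. bracket m x y \<in> h}"

definition cartan_subalgebra :: "'n::finite product \<Rightarrow> (complex ^ 'n) set \<Rightarrow> bool" where
  "cartan_subalgebra m h \<longleftrightarrow> lie_subalgebra m h \<and>
     (\<exists>k. lower_central m h k = {0}) \<and> lie_normalizer m h = h"

text \<open>A functional on \<open>h\<close> is a total function of which only the values on \<open>h\<close> matter.\<close>

definition functional_on :: "(complex ^ 'n::finite) set \<Rightarrow> (complex ^ 'n \<Rightarrow> complex) \<Rightarrow> bool" where
  "functional_on h f \<longleftrightarrow> (\<forall>x\<in>h. \<forall>y\<in>h. f (x + y) = f x + f y) \<and>
     (\<forall>a. \<forall>x\<in>h. f (a *s x) = a * f x)"

definition root_subspace ::
  "'n::finite product \<Rightarrow> (complex ^ 'n) set \<Rightarrow> (complex ^ 'n \<Rightarrow> complex) \<Rightarrow> (complex ^ 'n) set" where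
  "root_subspace \<rho> h f = {v. \<forall>x\<in>h. \<exists>k. ((\<lambda>w. \<rho> x w - f x *s w) ^^ k) v = 0}"

text \<open>
  The property that singles out the Cartan subalgebra of the canonical decomposition; the
  components of that decomposition are the sets \<open>root_subspace m h f\<close>.
\<close>

definition canonical_cartan :: "'n::finite product \<Rightarrow> (complex ^ 'n) set \<Rightarrow> bool" where
  "canonical_cartan m h \<longleftrightarrow> cartan_subalgebra m h \<and>
     (\<forall>f. functional_on h f \<longrightarrow> root_subspace m h f = root_subspace (bracket m) h f)"


definition Spec :: "'n::finite product \<Rightarrow> (complex ^ 'n) set \<Rightarrow> complex ^ 'n \<Rightarrow> complex set" where
  "Spec m h e0 = {f e0 | f. functional_on h f \<and> root_subspace m h f \<noteq> {0}}"

definition root_base ::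
  "'n::finite product \<Rightarrow> (complex ^ 'n) set \<Rightarrow> complex ^ 'n \<Rightarrow> (complex \<Rightarrow> complex ^ 'n) \<Rightarrow> bool" where
  "root_base m h e0 e \<longleftrightarrow> e 0 = e0 \<and>
     (\<forall>f. functional_on h f \<and> root_subspace m h f \<noteq> {0} \<longrightarrow>
        e (f e0) \<in> root_subspace m h f \<and> e (f e0) \<noteq> 0 \<and> m e0 (e (f e0)) = f e0 *s e (f e0)) \<and>
     (\<forall>l. l \<notin> Spec m h e0 \<longrightarrow> e l = 0)"

text \<open>
  The structure constants \<open>c\<^bsub>l,k\<^esub>\<close> of \<open>e\<^sub>l e\<^sub>k = c\<^bsub>l,k\<^esub> e\<^bsub>l+k\<^esub>\<close>. If \<open>l + k \<notin> S\<close> then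
  \<open>e\<^bsub>l+k\<^esub> = 0\<close> leaves the constant undetermined and we put it to \<open>0\<close>; the graphs do not
  depend on this choice.
\<close>

definition structure_const ::
  "'n::finite product \<Rightarrow> complex set \<Rightarrow> (complex \<Rightarrow> complex ^ 'n) \<Rightarrow> complex \<Rightarrow> complex \<Rightarrow> complex" where
  "structure_const m S e l k =
     (if l \<in> S \<and> k \<in> S \<and> l + k \<in> S then (THE c. m (e l) (e k) = c *s e (l + k)) else 0)"

text \<open>A directed graph with vertex set \<open>S\<close> is given by its edge relation, a subset of \<open>S \<times> S\<close>.\<close>

definition Gamma_l ::
  "'n::finite product \<Rightarrow> complex set \<Rightarrow> (complex \<Rightarrow> complex ^ 'n) \<Rightarrow> (complex \<times> complex) set" where
  "Gamma_l m S e = {(l, k). l \<in> S \<and> k \<in> S \<and> structure_const m S e (k - l) l \<noteq> 0}"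

definition Gamma_r ::
  "'n::finite product \<Rightarrow> complex set \<Rightarrow> (complex \<Rightarrow> complex ^ 'n) \<Rightarrow> (complex \<times> complex) set" where
  "Gamma_r m S e = {(l, k). l \<in> S \<and> k \<in> S \<and> structure_const m S e l (k - l) \<noteq> 0}"

end

theory Submission
  imports Defs "HOL-Computational_Algebra.Fundamental_Theorem_Algebra"
begin

text \<open>
  The vectors \<open>e k\<close> with \<open>k\<close> reachable from \<open>l\<close> span an ideal: multiplying \<open>e k\<close> by a root
  vector on the right or on the left follows an edge of \<open>\<Gamma>\<^sub>r\<close> or of \<open>\<Gamma>\<^sub>l\<close>, or gives \<open>0\<close>. The
  ideal contains \<open>e l \<noteq> 0\<close>, so by simplicity it is everything and contains \<open>e0\<close>; as the \<open>e k\<close>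
  are eigenvectors of \<open>L(e0)\<close> for different eigenvalues \<open>k\<close>, the vertex \<open>0\<close> is among the
  reachable ones.

  This argument presupposes the grading, which is recovered as follows. Since a Cartan subalgebra
  is nilpotent and its root subspace for \<open>0\<close> is at most a line, it is the line \<open>\<complex> e0\<close>
  (\<open>canonical_cartan_eq_line\<close>); hence root subspaces are generalized eigenspaces of the single
  operator \<open>L(e0)\<close> (\<open>root_subspace_line\<close>) and functionals on it are numbers. Each generalized
  eigenspace is a line, so \<open>L(e0)\<close> has no nontrivial Jordan block and its eigenvectors span
  (\<open>span_eigenvectors_eq_UNIV\<close>). The canonical condition forces \<open>ad e0\<close> to have the same
  eigenvalue \<open>k\<close> on \<open>e k\<close>, and left symmetry, read as \<open>x(yz) = [x,y]z + y(xz)\<close>, then shows that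
  \<open>e j\<close> times \<open>e k\<close> has the eigenvalue \<open>j + k\<close>.
\<close>

section \<open>Linear algebra over the complex numbers\<close>

lemma linear_props:
  assumes "Vector_Spaces.linear (*s) (*s) T"
  shows "T (x + y) = T x + T y" "T (c *s x) = c *s T x" "T (x - y) = T x - T y" "T 0 = 0"
    "T (sum g A) = (\<Sum>i\<in>A. T (g i))"
proof -
  interpret T: Vector_Spaces.linear "(*s)" "(*s)" T by fact
  show "T (x + y) = T x + T y" "T (c *s x) = c *s T x" "T (x - y) = T x - T y" "T 0 = 0"
    "T (sum g A) = (\<Sum>i\<in>A. T (g i))"
    by (simp_all add: T.add T.scale T.diff T.sum)
qed

lemma funpow_scaled:
  fixes N :: "complex ^ 'n \<Rightarrow> complex ^ 'n"
  assumes "\<And>c x. N (c *s x) = c *s N x"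
  shows "((\<lambda>w. a *s N w) ^^ k) v = a ^ k *s (N ^^ k) v"
  by (induction k) (simp_all add: assms)

lemma funpow_eigenvector:
  fixes N :: "complex ^ 'n \<Rightarrow> complex ^ 'n"
  assumes "\<And>c x. N (c *s x) = c *s N x" and "N v = a *s v"
  shows "(N ^^ k) v = a ^ k *s v"
  by (induction k) (simp_all add: assms mult.commute)

lemma subset_span_of_dim_le_1:
  fixes S :: "(complex ^ 'n::finite) set"
  assumes "vec.dim S \<le> 1" and "u \<in> S" and "u \<noteq> 0"
  shows "S \<subseteq> vec.span {u}"
  using vec.card_ge_dim_independent[of "{u}" S] assms by simp

lemma bilinear_span_mem:
  assumes "bilinear_product m" and "vec.subspace J"
    and "\<And>a b. a \<in> A \<Longrightarrow> b \<in> B \<Longrightarrow> m a b \<in> J"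
    and "x \<in> vec.span A" and "y \<in> vec.span B"
  shows "m x y \<in> J"
proof -
  note lin = assms(1)[unfolded bilinear_product_def]
  note l1 = linear_props[OF lin[THEN conjunct1, THEN spec]]
  note l2 = linear_props[OF lin[THEN conjunct2, THEN spec]]
  have *: "m a y \<in> J" if "a \<in> A" for a
    using assms(5)
  proof (induction rule: vec.span_induct_alt)
    case base
    then show ?case using assms(2) by (simp add: l1 vec.subspace_0)
  next
    case (step c x y)
    then show ?case using assms(2,3) that
      by (simp add: l1 vec.subspace_add vec.subspace_scale)
  qed
  show ?thesis
    using assms(4)
  proof (induction rule: vec.span_induct_alt)
    case base
    then show ?case using assms(2) by (simp add: l2 vec.subspace_0)
  next
    case (step c x z)
    then show ?case using assms(2) *
      by (simp add: l2 vec.subspace_add vec.subspace_scale)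
  qed
qed

text \<open>
  Eigenvectors for nonzero eigenvalues span a space that meets the kernel trivially. Every vector
  of the span is annihilated by a product of factors \<open>T - k\<close> with \<open>k \<noteq> 0\<close>, and such a product
  multiplies a vector of the kernel by a nonzero number.
\<close>

lemma span_nonzero_eigenvectors_kernel:
  fixes T :: "complex ^ 'n::finite \<Rightarrow> complex ^ 'n"
  assumes lin: "Vector_Spaces.linear (*s) (*s) T"
    and A: "\<And>a. a \<in> A \<Longrightarrow> \<exists>k. k \<noteq> 0 \<and> T a = k *s a"
    and x: "x \<in> vec.span A" and Tx: "T x = 0"
  shows "x = 0"
proof -
  note l = linear_props[OF lin]
  define P where "P = fold (\<lambda>k w. T w - k *s w)"
  have P_Nil: "P [] v = v" and P_Cons: "P (k # ks) v = P ks (T v - k *s v)" for k ks v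
    by (simp_all add: P_def)
  have P_diff: "P ks (v - w) = P ks v - P ks w" for ks v w
  proof (induction ks arbitrary: v w)
    case (Cons k ks)
    have "T (v - w) - k *s (v - w) = (T v - k *s v) - (T w - k *s w)"
      by (simp add: l vec.scale_right_diff_distrib)
    then show ?case using Cons by (simp add: P_Cons)
  qed (simp add: P_Nil)
  have P_scale: "P ks (c *s v) = c *s P ks v" for ks c v
  proof (induction ks arbitrary: v)
    case (Cons k ks)
    have "T (c *s v) - k *s (c *s v) = c *s (T v - k *s v)"
      by (simp add: l vec.scale_right_diff_distrib mult.commute)
    then show ?case using Cons.IH[of "T v - k *s v"] by (simp only: P_Cons)
  qed (simp add: P_Nil)
  have P_T: "P ks (T v) = T (P ks v)" for ks v
  proof (induction ks arbitrary: v)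
    case (Cons k ks)
    have "T (T v) - k *s T v = T (T v - k *s v)" by (simp add: l)
    then show ?case using Cons by (simp add: P_Cons)
  qed (simp add: P_Nil)
  have "\<exists>ks. 0 \<notin> set ks \<and> P ks x = 0"
    using x
  proof (induction rule: vec.span_induct_alt)
    case base
    show ?case by (rule exI[of _ "[]"]) (simp add: P_Nil)
  next
    case (step c a y)
    obtain k where k: "k \<noteq> 0" "T a = k *s a" using A[OF step(1)] by blast
    obtain ks where ks: "0 \<notin> set ks" "P ks y = 0" using step by blast
    have "T (c *s a + y) - k *s (c *s a + y) = T y - k *s y"
      by (simp add: l k vec.scale_right_distrib mult.commute)
    then have "P (k # ks) (c *s a + y) = 0"
      using ks by (simp add: P_Cons P_diff P_scale P_T l)
    then show ?case using k ks by (intro exI[of _ "k # ks"]) simp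
  qed
  then obtain ks where ks: "0 \<notin> set ks" "P ks x = 0" by blast
  have "P ks v = (\<Prod>k\<leftarrow>ks. - k) *s v" if "T v = 0" for v
    using that
  proof (induction ks arbitrary: v)
    case (Cons k ks)
    have "T v - k *s v = (- k) *s v" using Cons by simp
    moreover have "T ((- k) *s v) = 0" using Cons by (simp only: l) simp
    ultimately show ?case using Cons.IH[of "(- k) *s v"]
      by (simp add: P_Cons mult.commute del: vec.scale_minus_left)
  qed (simp add: P_Nil)
  from this[OF Tx] ks have "(\<Prod>k\<leftarrow>ks. - k) = 0 \<or> x = 0" by simp
  moreover have "(\<Prod>k\<leftarrow>ks. - k) \<noteq> 0" using ks(1) by (induction ks) auto
  ultimately show ?thesis by blast
qed

lemma span_image_lessThan:
  fixes b :: "nat \<Rightarrow> complex ^ 'n::finite"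
  assumes "x \<in> vec.span (b ` {..<k})"
  shows "\<exists>c. x = (\<Sum>i<k. c i *s b i)"
  using assms
proof (induction k arbitrary: x)
  case (Suc k)
  then obtain a where "x - a *s b k \<in> vec.span (b ` {..<k})"
    by (auto simp: lessThan_Suc vec.span_breakdown_eq)
  then obtain c where c: "x - a *s b k = (\<Sum>i<k. c i *s b i)" using Suc.IH by blast
  have "x = (\<Sum>i<Suc k. (c(k := a)) i *s b i)"
    using c by (simp add: algebra_simps)
  then show ?case by blast
qed simp

text \<open>
  Otherwise the initial segments of \<open>b\<close> would be arbitrarily large independent sets. Applied to the
  iterates \<open>(T ^^ i) v\<close> of an operator, this yields an annihilating polynomial of \<open>v\<close>.
\<close>

lemma ex_in_span_of_previous:
  fixes b :: "nat \<Rightarrow> complex ^ 'n::finite"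
  shows "\<exists>k. b k \<in> vec.span (b ` {..<k})"
proof (rule ccontr)
  assume "\<nexists>k. b k \<in> vec.span (b ` {..<k})"
  then have neg: "b k \<notin> vec.span (b ` {..<k})" for k by simp
  have "vec.independent (b ` {..<k}) \<and> card (b ` {..<k}) = k" for k
  proof (induction k)
    case (Suc k)
    have "b k \<notin> b ` {..<k}" using neg[of k] vec.span_base[of "b k" "b ` {..<k}"] by argo
    then show ?case using Suc neg[of k]
      by (simp add: lessThan_Suc vec.independent_insert)
  qed (simp add: vec.independent_empty)
  from this[of "Suc (vec.dim (UNIV :: (complex ^ 'n) set))"] show False
    using vec.independent_card_le_dim[of _ "UNIV :: (complex ^ 'n) set"] by force
qed

text \<open>
  An annihilating polynomial of \<open>v\<close> splits into linear factors, so a subspace through which one can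
  divide by every factor \<open>T - a\<close> contains \<open>v\<close>.
\<close>

lemma mem_of_polynomial_mem:
  fixes T :: "complex ^ 'n::finite \<Rightarrow> complex ^ 'n"
  assumes lin: "Vector_Spaces.linear (*s) (*s) T"
    and W: "vec.subspace W"
    and div: "\<And>a v. T v - a *s v \<in> W \<Longrightarrow> v \<in> W"
    and "p \<noteq> 0" and "(\<Sum>i\<le>degree p. coeff p i *s (T ^^ i) v) \<in> W"
  shows "v \<in> W"
  using assms(4,5)
proof (induction "degree p" arbitrary: p)
  case 0
  then have c: "coeff p 0 \<noteq> 0" "coeff p 0 *s v \<in> W"
    using leading_coeff_neq_0[of p] by simp_all
  then have "inverse (coeff p 0) *s (coeff p 0 *s v) \<in> W"
    using W vec.subspace_scale by blast
  then show ?case using c by simp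
next
  case (Suc n)
  note l = linear_props[OF lin]
  define ev where "ev q k = (\<Sum>i\<le>k. coeff q i *s (T ^^ i) v)" for q k
  obtain a where a: "poly p a = 0"
    using fundamental_theorem_of_algebra_alt[of p] Suc by (metis degree_pCons_0 nat.distinct(1))
  define q where "q = synthetic_div p a"
  have p: "p = pCons 0 q - smult a q"
    using synthetic_div_correct[of p a] a by (simp add: q_def algebra_simps)
  have deg: "degree q = n" using Suc by (simp add: q_def degree_synthetic_div)
  have "q \<noteq> 0" using p Suc by auto
  have "ev p (Suc n) = ev (pCons 0 q) (Suc n) - a *s ev q (Suc n)"
    by (simp add: ev_def p vec.scale_left_diff_distrib sum_subtractf vec.scale_sum_right
        del: sum.atMost_Suc)
  also have "ev (pCons 0 q) (Suc n) = T (ev q n)"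
    by (simp add: ev_def sum.atMost_Suc_shift l del: sum.atMost_Suc)
  also have "ev q (Suc n) = ev q n"
    using deg by (simp add: ev_def coeff_eq_0)
  finally have "T (ev q n) - a *s ev q n \<in> W"
    using Suc by (simp add: ev_def)
  then have "ev q n \<in> W" by (rule div)
  then show ?case using Suc(1)[of q] deg \<open>q \<noteq> 0\<close> by (simp add: ev_def)
qed

text \<open>
  An operator without Jordan blocks of size two is diagonalizable. Let \<open>W\<close> be the span of the
  eigenvectors. On \<open>W\<close> the operator \<open>T - a\<close> is onto up to its kernel; so if \<open>(T - a) v\<close> lies in
  \<open>W\<close>, then \<open>v\<close> differs by an element of \<open>W\<close> from a vector annihilated by \<open>(T - a)\<^sup>2\<close>, which by
  hypothesis is an eigenvector.
\<close>

lemma span_eigenvectors_eq_UNIV: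
  fixes T :: "complex ^ 'n::finite \<Rightarrow> complex ^ 'n"
  assumes lin: "Vector_Spaces.linear (*s) (*s) T"
    and semisimple: "\<And>a v. T (T v - a *s v) = a *s (T v - a *s v) \<Longrightarrow> T v = a *s v"
  shows "vec.span {v. \<exists>a. T v = a *s v} = UNIV"
proof -
  note l = linear_props[OF lin]
  define W where "W = vec.span {v. \<exists>a. T v = a *s v}"
  have W: "vec.subspace W" by (simp add: W_def)
  have split: "\<exists>u\<in>W. \<exists>z. T z = a *s z \<and> w = (T u - a *s u) + z" if "w \<in> W" for w a
    using that[unfolded W_def]
  proof (induction rule: vec.span_induct_alt)
    case base
    show ?case by (intro bexI[of _ 0] exI[of _ 0]) (simp_all add: l W vec.subspace_0)
  next
    case (step c x y)
    obtain k where k: "T x = k *s x" using step(1) by blast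
    obtain u z where uz: "u \<in> W" "T z = a *s z" "y = (T u - a *s u) + z"
      using step(2) by blast
    have x: "x \<in> W" using step(1) unfolding W_def by (rule vec.span_base)
    show ?case
    proof (cases "k = a")
      case True
      have "T (c *s x + z) = a *s (c *s x + z)"
        by (simp add: l uz k True vec.scale_right_distrib mult.commute)
      then show ?thesis using uz
        by (intro bexI[of _ u] exI[of _ "c *s x + z"] conjI) (simp_all add: algebra_simps)
    next
      case False
      define d where "d = c / (k - a)"
      have "T (d *s x) - a *s (d *s x) = (d * (k - a)) *s x"
        by (simp add: l k right_diff_distrib vec.scale_left_diff_distrib mult.commute)
      moreover have "d * (k - a) = c" using False by (simp add: d_def)
      moreover have "d *s x + u \<in> W" using x uz W by (simp add: vec.subspace_add vec.subspace_scale)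
      ultimately show ?thesis using uz
        by (intro bexI[of _ "d *s x + u"] exI[of _ z] conjI)
          (simp_all add: l vec.scale_right_distrib)
    qed
  qed
  have div: "v \<in> W" if v: "T v - a *s v \<in> W" for a v
  proof -
    obtain u z where uz: "u \<in> W" "T z = a *s z" "T v - a *s v = (T u - a *s u) + z"
      using split[OF v] by blast
    have "T (v - u) - a *s (v - u) = z"
      using uz(3) by (simp add: l vec.scale_right_diff_distrib algebra_simps)
    then have "T (v - u) = a *s (v - u)" using uz(2) by - (rule semisimple, simp)
    then have "v - u \<in> W" unfolding W_def by (intro vec.span_base CollectI exI)
    from vec.subspace_add[OF W this uz(1)] show ?thesis by simp
  qed
  have "v \<in> W" for v
  proof -
    obtain k where "(T ^^ k) v \<in> vec.span ((\<lambda>i. (T ^^ i) v) ` {..<k})"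
      using ex_in_span_of_previous[of "\<lambda>i. (T ^^ i) v"] by blast
    then obtain c where c: "(T ^^ k) v = (\<Sum>i<k. c i *s (T ^^ i) v)"
      using span_image_lessThan[of "(T ^^ k) v" "\<lambda>i. (T ^^ i) v" k] by blast
    define p where "p = monom 1 k - (\<Sum>i<k. monom (c i) i)"
    have co: "coeff p i = (if i = k then 1 else if i < k then - c i else 0)" for i
      by (simp add: p_def coeff_sum)
    have deg: "degree p = k"
      by (rule antisym) (auto intro!: degree_le le_degree simp: co)
    have "(\<Sum>i\<le>k. coeff p i *s (T ^^ i) v) = 0"
      by (simp add: co c sum_negf flip: lessThan_Suc_atMost)
    moreover have "p \<noteq> 0" using co[of k] by auto
    ultimately show ?thesis
      using mem_of_polynomial_mem[OF lin W div, where p = p and v = v] W deg by (simp add: vec.subspace_0)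
  qed
  then show ?thesis unfolding W_def by blast
qed

section \<open>The Cartan subalgebra as a line\<close>

lemma subalgebra_subset_root_subspace_0:
  assumes "lower_central m h k = {0}"
  shows "h \<subseteq> root_subspace (bracket m) h (\<lambda>x. 0)"
proof
  fix y assume y: "y \<in> h"
  have "((\<lambda>w. bracket m x w - 0 *s w) ^^ j) y \<in> lower_central m h j" if "x \<in> h" for x j
  proof (induction j)
    case (Suc j)
    then show ?case using that by (auto intro!: vec.span_base)
  qed (simp add: y)
  then show "y \<in> root_subspace (bracket m) h (\<lambda>x. 0)"
    using assms unfolding root_subspace_def by blast
qed

text \<open>
  The Cartan subalgebra lies in its root subspace for \<open>0\<close>, which is at most a line. It is not zero,
  because the normalizer of the zero subalgebra is the whole algebra.
\<close>

lemma canonical_cartan_eq_line: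
  assumes bil: "bilinear_product m" and can: "canonical_cartan m h"
    and dim: "vec.dim (root_subspace m h (\<lambda>x. 0)) \<le> 1"
    and e0: "e0 \<in> root_subspace m h (\<lambda>x. 0)" "e0 \<noteq> 0"
  shows "h = vec.span {e0}"
proof
  note lin = bil[unfolded bilinear_product_def]
  note l1 = linear_props[OF lin[THEN conjunct1, THEN spec]]
  note l2 = linear_props[OF lin[THEN conjunct2, THEN spec]]
  have sub: "vec.subspace h" and norm: "lie_normalizer m h = h"
    using can by (auto simp: canonical_cartan_def cartan_subalgebra_def lie_subalgebra_def)
  obtain k where "lower_central m h k = {0}"
    using can by (auto simp: canonical_cartan_def cartan_subalgebra_def)
  moreover have "functional_on h (\<lambda>x. 0)" by (simp add: functional_on_def)
  ultimately have "h \<subseteq> root_subspace m h (\<lambda>x. 0)"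
    using subalgebra_subset_root_subspace_0 can unfolding canonical_cartan_def by metis
  then show hsub: "h \<subseteq> vec.span {e0}"
    using subset_span_of_dim_le_1[OF dim e0] by blast
  have "h \<noteq> {0}"
  proof
    assume "h = {0}"
    then have "e0 \<in> lie_normalizer m h" by (simp add: lie_normalizer_def bracket_def l1 l2)
    then show False using norm \<open>h = {0}\<close> e0 by simp
  qed
  then obtain y where y: "y \<in> h" "y \<noteq> 0" using sub vec.subspace_0 by blast
  then obtain c where c: "y = c *s e0" using hsub by (auto simp: vec.span_singleton)
  then have "e0 = inverse c *s y" using y by simp
  then have "e0 \<in> h" using y sub vec.subspace_scale by metis
  then show "vec.span {e0} \<subseteq> h" using sub by (simp add: vec.span_minimal)
qed

text \<open>
  Over a Cartan subalgebra that is a line, one operator decides membership in a root subspace: all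
  others are its multiples.
\<close>

lemma root_subspace_line:
  assumes f: "functional_on (vec.span {x}) f"
    and scale: "\<And>a w. \<rho> (a *s x) w = a *s \<rho> x w" "\<And>a w. \<rho> x (a *s w) = a *s \<rho> x w"
  shows "v \<in> root_subspace \<rho> (vec.span {x}) f \<longleftrightarrow>
    (\<exists>k. ((\<lambda>w. \<rho> x w - f x *s w) ^^ k) v = 0)"
proof
  assume "v \<in> root_subspace \<rho> (vec.span {x}) f"
  moreover have "x \<in> vec.span {x}" by (simp add: vec.span_base)
  ultimately show "\<exists>k. ((\<lambda>w. \<rho> x w - f x *s w) ^^ k) v = 0"
    by (auto simp: root_subspace_def)
next
  assume "\<exists>k. ((\<lambda>w. \<rho> x w - f x *s w) ^^ k) v = 0"
  then obtain k where k: "((\<lambda>w. \<rho> x w - f x *s w) ^^ k) v = 0" by blast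
  have "((\<lambda>w. \<rho> y w - f y *s w) ^^ k) v = 0" if y: "y \<in> vec.span {x}" for y
  proof -
    obtain a where y: "y = a *s x" using y by (auto simp: vec.span_singleton)
    have "f y = a * f x" using f y by (simp add: functional_on_def vec.span_base)
    then have "(\<lambda>w. \<rho> y w - f y *s w) = (\<lambda>w. a *s (\<rho> x w - f x *s w))"
      by (simp add: y scale vec.scale_right_diff_distrib)
    moreover have "((\<lambda>w. a *s (\<rho> x w - f x *s w)) ^^ k) v = a ^ k *s ((\<lambda>w. \<rho> x w - f x *s w) ^^ k) v"
      by (rule funpow_scaled) (simp add: scale vec.scale_right_diff_distrib mult.commute)
    ultimately show ?thesis using k by simp
  qed
  then show "v \<in> root_subspace \<rho> (vec.span {x}) f"
    unfolding root_subspace_def by blast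
qed

lemma functional_on_line_with_value:
  fixes x :: "complex ^ 'n::finite"
  assumes "x \<noteq> 0"
  shows "\<exists>f. functional_on (vec.span {x}) f \<and> f x = a"
proof -
  obtain i where i: "x $ i \<noteq> 0" using assms by (auto simp: vec_eq_iff)
  show ?thesis
    by (rule exI[of _ "\<lambda>v. a * (v $ i / x $ i)"])
      (use i in \<open>simp add: functional_on_def add_divide_distrib distrib_left\<close>)
qed

section \<open>Reachability of the vertex zero\<close>

theorem mainTheorem10:
  fixes m :: "'n::finite product"
    and h :: "(complex ^ 'n) set"
    and e0 :: "complex ^ 'n"
    and e :: "complex \<Rightarrow> complex ^ 'n"
    and l :: complex
  assumes "left_symmetric_algebra m"
    and "complete_lsa m"
    and "simple_lsa m"
    and "canonical_cartan m h"
    and "\<And>f. functional_on h f \<Longrightarrow> vec.dim (root_subspace m h f) \<le> 1"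
    and "e0 \<in> root_subspace m h (\<lambda>x. 0)" and "e0 \<noteq> 0"
    and "root_base m h e0 e"
    and "l \<in> Spec m h e0"
  shows "(l, 0) \<in> (Gamma_l m (Spec m h e0) e \<union> Gamma_r m (Spec m h e0) e)\<^sup>*"
proof -
  have bil: "bilinear_product m"
    and lsym: "\<And>x y z. m x (m y z) - m (m x y) z = m y (m x z) - m (m y x) z"
    using assms(1) by (auto simp: left_symmetric_algebra_def)
  note lin1 = bil[unfolded bilinear_product_def, THEN conjunct1, THEN spec]
  note l1 = linear_props[OF lin1]
  note l2 = linear_props[OF bil[unfolded bilinear_product_def, THEN conjunct2, THEN spec]]
  define T where "T = m e0"
  define S where "S = Spec m h e0"
  have linT: "Vector_Spaces.linear (*s) (*s) T" using lin1 by (simp add: T_def)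
  note lT = linear_props[OF linT]
  have h: "h = vec.span {e0}"
    by (rule canonical_cartan_eq_line[OF bil assms(4) assms(5) assms(6,7)])
      (simp add: functional_on_def)
  have root_m: "v \<in> root_subspace m h f \<longleftrightarrow> (\<exists>k. ((\<lambda>w. T w - f e0 *s w) ^^ k) v = 0)"
    if "functional_on h f" for f v
    unfolding h T_def using that l1 l2 by (intro root_subspace_line) (simp_all add: h)
  have root_ad: "v \<in> root_subspace m h f \<longleftrightarrow> (\<exists>k. ((\<lambda>w. bracket m e0 w - f e0 *s w) ^^ k) v = 0)"
    if "functional_on h f" for f v
  proof -
    have "root_subspace m h f = root_subspace (bracket m) h f"
      using that assms(4) by (simp add: canonical_cartan_def)
    also have "v \<in> \<dots> \<longleftrightarrow> (\<exists>k. ((\<lambda>w. bracket m e0 w - f e0 *s w) ^^ k) v = 0)"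
      unfolding h using that l1 l2
      by (intro root_subspace_line)
        (simp_all add: h bracket_def vec.scale_right_diff_distrib)
    finally show ?thesis .
  qed
  have e_spec: "e k \<noteq> 0" "T (e k) = k *s e k"
    "\<exists>f. functional_on h f \<and> f e0 = k \<and> e k \<in> root_subspace m h f" if "k \<in> S" for k
    using that assms(8) unfolding S_def Spec_def root_base_def T_def by blast+
  have root_line: "k \<in> S \<and> v \<in> vec.span {e k}"
    if v: "v \<in> root_subspace m h f" "v \<noteq> 0" and f: "functional_on h f" "f e0 = k" for f k v
  proof -
    have ne: "root_subspace m h f \<noteq> {0}" using v by blast
    then have "k \<in> S" using f unfolding S_def Spec_def by blast
    moreover have "e k \<in> root_subspace m h f" "e k \<noteq> 0"
      using ne f assms(8) unfolding root_base_def by blast+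
    ultimately show ?thesis
      using subset_span_of_dim_le_1[OF assms(5)[OF f(1)]] v by blast
  qed
  have gen_eigen: "k \<in> S \<and> v \<in> vec.span {e k}"
    if v: "((\<lambda>w. T w - k *s w) ^^ j) v = 0" "v \<noteq> 0" for k v j
  proof -
    obtain f where f: "functional_on h f" "f e0 = k"
      using functional_on_line_with_value[OF assms(7)] h by blast
    then have "v \<in> root_subspace m h f" using v root_m by blast
    then show ?thesis using root_line v f by blast
  qed
  have eigen: "k \<in> S \<and> v \<in> vec.span {e k}" if "T v = k *s v" "v \<noteq> 0" for k v
    using gen_eigen[where k = k and v = v and j = 1] that by simp

  have span_e: "vec.span (e ` S) = UNIV"
  proof -
    have "vec.span {v. \<exists>a. T v = a *s v} = UNIV"
    proof (rule span_eigenvectors_eq_UNIV[OF linT])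
      fix a v assume v: "T (T v - a *s v) = a *s (T v - a *s v)"
      show "T v = a *s v"
      proof (cases "v = 0")
        case False
        have "((\<lambda>w. T w - a *s w) ^^ 2) v = 0" using v by (simp add: numeral_2_eq_2)
        then have "a \<in> S" "v \<in> vec.span {e a}" using gen_eigen False by blast+
        then show ?thesis using e_spec(2)
          by (auto simp: vec.span_singleton lT mult.commute)
      qed (simp add: lT)
    qed
    moreover have "v \<in> vec.span (e ` S)" if "T v = a *s v" for a v
    proof (cases "v = 0")
      case False
      then have "a \<in> S" "v \<in> vec.span {e a}" using eigen that by blast+
      then show ?thesis using vec.span_mono[of "{e a}" "e ` S"] by blast
    qed (simp add: vec.span_zero)
    then have "{v. \<exists>a. T v = a *s v} \<subseteq> vec.span (e ` S)" by blast
    ultimately show ?thesis using vec.span_minimal[OF _ vec.subspace_span] by blast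
  qed

  have ad_e: "bracket m e0 (e k) = k *s e k" if k: "k \<in> S" for k
  proof -
    define N where "N = (\<lambda>w. bracket m e0 w - k *s w)"
    have N_scale: "N (c *s w) = c *s N w" for c w
      by (simp add: N_def bracket_def l1 l2 vec.scale_right_diff_distrib mult.commute)
    have N0: "N 0 = 0" using N_scale[of 0 0] by simp
    obtain f where f: "functional_on h f" "f e0 = k" "e k \<in> root_subspace m h f"
      using e_spec(3)[OF k] by blast
    then obtain j where j: "(N ^^ j) (e k) = 0" using root_ad N_def by blast
    then have "(N ^^ j) (N (e k)) = 0" using N0 by (simp add: funpow_swap1 [symmetric])
    then have Nroot: "N (e k) \<in> root_subspace m h f" using root_ad f N_def by blast
    \<comment> \<open>The root subspace is a line stable under \<open>N\<close>, on which \<open>N\<close> is nilpotent, hence zero.\<close>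
    have "N (e k) \<in> vec.span {e k}"
      by (cases "N (e k) = 0") (use root_line[OF Nroot _ f(1,2)] vec.span_zero in auto)
    then obtain c where c: "N (e k) = c *s e k" by (auto simp: vec.span_singleton)
    then have "c ^ j *s e k = 0" using j funpow_eigenvector[OF N_scale c] by simp
    then have "c = 0" using e_spec(1)[OF k] by simp
    then show ?thesis using c by (simp add: N_def)
  qed

  \<comment> \<open>Outside the spectrum \<open>e\<close> vanishes, so a nonzero \<open>c\<close> is only meaningful when \<open>k + j \<in> S\<close>;
      thus \<open>c \<noteq> 0\<close> amounts to having an edge.\<close>
  have prod: "\<exists>c. (k + j \<in> S \<longrightarrow> structure_const m S e k j = c) \<and>
      m (e k) (e j) = c *s e (k + j) \<and> (k + j \<notin> S \<longrightarrow> c = 0)"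
    if k: "k \<in> S" and j: "j \<in> S" for k j
  proof -
    have "T (m (e k) (e j)) = m (bracket m e0 (e k)) (e j) + m (e k) (T (e j))"
      using lsym[of e0 "e k" "e j"] by (simp add: T_def bracket_def l2 algebra_simps)
    also have "\<dots> = (k + j) *s m (e k) (e j)"
      by (simp add: ad_e k j e_spec(2) l1 l2 vec.scale_left_distrib)
    finally have eig: "T (m (e k) (e j)) = (k + j) *s m (e k) (e j)" .
    show ?thesis
    proof (cases "k + j \<in> S")
      case True
      have "m (e k) (e j) \<in> vec.span {e (k + j)}"
        by (cases "m (e k) (e j) = 0") (use eigen[OF eig] vec.span_zero in auto)
      then obtain c where c: "m (e k) (e j) = c *s e (k + j)" by (auto simp: vec.span_singleton)
      have "structure_const m S e k j = c"
        using k j True e_spec(1)[OF True] c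
        by (auto simp: structure_const_def intro!: the_equality)
      then show ?thesis using c True by blast
    next
      case False
      then have "m (e k) (e j) = 0" using eigen[OF eig] by blast
      then show ?thesis using False by (intro exI[of _ 0]) simp
    qed
  qed

  define G where "G = Gamma_l m S e \<union> Gamma_r m S e"
  define R where "R = {k \<in> S. (l, k) \<in> G\<^sup>*}"
  define J where "J = vec.span (e ` R)"
  have J: "vec.subspace J" by (simp add: J_def)
  have mem: "c *s e k \<in> J" if "k \<in> R" for k c
    using that J unfolding J_def by (intro vec.subspace_scale vec.span_base) auto
  have right: "m (e k) (e j) \<in> J" and left: "m (e j) (e k) \<in> J" if k: "k \<in> R" and j: "j \<in> S" for k j
  proof -
    have kS: "k \<in> S" and path: "(l, k) \<in> G\<^sup>*" using k by (auto simp: R_def)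
    have step: "k' \<in> R" if "(k, k') \<in> G" for k'
      using that path rtrancl_into_rtrancl[of l k G k'] by (auto simp: R_def G_def Gamma_l_def Gamma_r_def)
    obtain c where c: "k + j \<in> S \<longrightarrow> structure_const m S e k j = c"
      "m (e k) (e j) = c *s e (k + j)" "k + j \<notin> S \<longrightarrow> c = 0" using prod[OF kS j] by blast
    show "m (e k) (e j) \<in> J"
    proof (cases "c = 0")
      case True
      then show ?thesis using c J by (simp add: vec.subspace_0)
    next
      case False
      then have "(k, k + j) \<in> G" using c kS by (auto simp: G_def Gamma_r_def)
      then show ?thesis using step mem c by simp
    qed
    obtain d where d: "j + k \<in> S \<longrightarrow> structure_const m S e j k = d"
      "m (e j) (e k) = d *s e (j + k)" "j + k \<notin> S \<longrightarrow> d = 0" using prod[OF j kS] by blast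
    show "m (e j) (e k) \<in> J"
    proof (cases "d = 0")
      case True
      then show ?thesis using d J by (simp add: vec.subspace_0)
    next
      case False
      then have "(k, j + k) \<in> G" using d kS by (auto simp: G_def Gamma_l_def)
      then show ?thesis using step mem d by simp
    qed
  qed
  have "lsa_ideal m J"
    unfolding lsa_ideal_def
  proof (intro conjI ballI allI J)
    fix x y assume x: "x \<in> J"
    have y: "y \<in> vec.span (e ` S)" by (simp add: span_e)
    show "m x y \<in> J"
      using bilinear_span_mem[OF bil J, of "e ` R" "e ` S" x y] right x y by (auto simp: J_def)
    show "m y x \<in> J"
      using bilinear_span_mem[OF bil J, of "e ` S" "e ` R" y x] left x y by (auto simp: J_def)
  qed
  moreover have lS: "l \<in> S" using assms(9) by (simp add: S_def)
  then have "l \<in> R" by (simp add: R_def)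
  then have "e l \<in> J" using mem[of l 1] by simp
  ultimately have "J = UNIV" using assms(3) e_spec(1)[OF lS] unfolding simple_lsa_def by blast
  then have e0J: "e0 \<in> vec.span (e ` R)" by (simp add: J_def)
  have f0: "functional_on h (\<lambda>x. 0)" by (simp add: functional_on_def)
  have "e 0 = e0" using assms(8) by (simp add: root_base_def)
  moreover have "0 \<in> S" using root_line[OF assms(6,7) f0] by simp
  ultimately have "T e0 = 0" using e_spec(2)[of 0] by simp
  \<comment> \<open>Otherwise \<open>e0\<close>, which \<open>T\<close> kills, is a combination of eigenvectors for nonzero eigenvalues.\<close>
  have "0 \<in> R"
  proof (rule ccontr)
    assume "0 \<notin> R"
    have "\<exists>k. k \<noteq> 0 \<and> T a = k *s a" if "a \<in> e ` R" for a
    proof -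
      obtain k where "k \<in> R" "a = e k" using \<open>a \<in> e ` R\<close> by blast
      moreover from this have "k \<noteq> 0" using \<open>0 \<notin> R\<close> by blast
      ultimately show ?thesis using e_spec(2)[of k] by (auto simp: R_def)
    qed
    then show False
      using span_nonzero_eigenvectors_kernel[OF linT _ e0J \<open>T e0 = 0\<close>] assms(7) by blast
  qed
  then show ?thesis by (simp add: R_def G_def S_def)
qed

end
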